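(* Let $n\ge 1$ and let $\rho\in L^1(\mathbb{R}^n)$ be a non-negative, rotationally symmetric kernel that is non-increasing in $|r|$ and decays to zero at infinity. Suppose $u:\mathbb{R}^n\times[0,\infty)\to\mathbb{R}$ is a sufficiently smooth (classical) solution of the non-local heat equation $$u_t(x,t)=L_{\mathbb{R}^n}u(x,t),\quad (x,t)\in\mathbb{R}^n\times(0,\infty),\qquad u(x,0)=u_0(x),\quad x\in\mathbb{R}^n,$$ with $\|u(\cdot,t)\|_{L^\infty(\mathbb{R}^n)}\le 1$ for all $t\ge 0$. Let $\varphi:[0,\infty)\times[0,\infty)\to[0,\infty)$ be a function with the following properties. (a) $\varphi'(r,t):=\partial\varphi(r,t)/\partial r>0$, and $\lim_{r\to0^+}\varphi(r,t)=\varphi(0,t)=0$ for each $t\ge0$. (b) $\varphi(\cdot,0)$ is a modulus of continuity for $u(\cdot,0)$. (c) The odd extension $\tilde\varphi(r,t)=\varphi(r,t)$ for $r\ge0$, $\tilde\varphi(r,t)=-\varphi(-r,t)$ for $r<0$, satisfies $\lim_{r\to\pm\infty}\tilde\varphi(r,t)=\pm1$ and is a (classical) solution of the one-dimensional non-local heat equation $$\tilde\varphi_t(r,t)=\int_{\mathbb{R}}\tilde\rho(w)\bigl(\tilde\varphi(r+w,t)-\tilde\varphi(r,t)\bigr)\,dw,\qquad r\in\mathbb{R},\ t>0,$$ where $\tilde\rho(w)=\int_{\mathbb{R}^{n-1}}\rho(w,p)\,dp$. Assume furthermore: (d) There exists a smooth, radially symmetric function $\Psi:\mathbb{R}^n\to[1,\infty)$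 such that $\Psi(x)\to\infty$ as $|x|\to\infty$, $L_{\mathbb{R}^n}\Psi(x)$ is well-defined for every $x\in\mathbb{R}^n$, and $$0\le K:=\sup_{x\in\mathbb{R}^n}L_{\mathbb{R}^n}\Psi(x)<\infty.$$ Then for every $t\ge0$, $\varphi(\cdot,t)$ is a modulus of continuity for $u(\cdot,t)$ on $\mathbb{R}^n$, i.e. $$|u(y,t)-u(x,t)|\le 2\varphi\left(\frac{|y-x|}{2},t\right)\qquad\text{for all }x,y\in\mathbb{R}^n,\ t\ge0.$$
   Context: The non-local operator is $L_{\mathbb{R}^n}u(x):=\int_{\mathbb{R}^n}\rho(z-x)(u(z)-u(x))\,dz$ (acting in the space variable). A function $\omega:[0,\infty)\to[0,\infty)$ is a modulus of continuity for $f:\Omega\subset\mathbb{R}^n\to\mathbb{R}$ if $\omega$ is continuous at zero, $\omega(0)=0$, and $|f(y)-f(x)|\le2\omega\left(\frac{|y-x|}{2}\right)$ for all $x,y\in\Omega$. When $n=1$, $\tilde\rho=\rho$. "Sufficiently smooth (classical) solution" means: $u$ and $\varphi$ are jointly continuous on $\mathbb{R}^n\times[0,\infty)$ and $[0,\infty)\times[0,\infty)$ respectively (in particular up to $t=0$), the time derivatives $u_t$ and $\tilde\varphi_t$ exist for $t>0$, and the equations hold pointwise. *)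

theory Defs
  imports "HOL-Analysis.Analysis" "HOL-Probability.Essential_Supremum"
begin

definition nonlocal_op :: "(real^'n \<Rightarrow> real) \<Rightarrow> (real^'n \<Rightarrow> real) \<Rightarrow> real^'n \<Rightarrow> real" where
  "nonlocal_op \<rho> u x = (\<integral>z. \<rho> (z - x) * (u z - u x) \<partial>lborel)"

definition radially_symmetric :: "('a::real_normed_vector \<Rightarrow> 'b) \<Rightarrow> bool" where
  "radially_symmetric f \<longleftrightarrow> (\<forall>x y. norm x = norm y \<longrightarrow> f x = f y)"

text \<open>The origin is excluded: an \<open>L\<^sup>1\<close> kernel may be singular there, so a real-valued
  representative need not attain its largest value at \<open>0\<close>.\<close>

definition radially_nonincreasing :: "('a::real_normed_vector \<Rightarrow> real) \<Rightarrow> bool" where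
  "radially_nonincreasing f \<longleftrightarrow> (\<forall>x y. 0 < norm x \<and> norm x \<le> norm y \<longrightarrow> f y \<le> f x)"

text \<open>The one-dimensional kernel \<open>w \<mapsto> \<integral> \<rho>(w, p) dp\<close>. The coordinate \<open>k\<close> carries \<open>w\<close>, and
  \<open>\<real>\<^sup>n\<^sup>-\<^sup>1\<close> with Lebesgue measure is the product measure over the remaining \<open>n - 1\<close> coordinates.
  If \<open>n = 1\<close>, this product is a one-point space of mass 1. For radially symmetric \<open>\<rho>\<close> the
  choice of \<open>k\<close> does not matter.\<close>

definition reduced_kernel :: "(real^'n \<Rightarrow> real) \<Rightarrow> 'n \<Rightarrow> real \<Rightarrow> real" where
  "reduced_kernel \<rho> k w =
     (\<integral>p. \<rho> (\<chi> i. if i = k then w else p i) \<partial>(\<Pi>\<^sub>M i\<in>UNIV - {k}. (lborel :: real measure)))"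

lemma reduced_kernel_dim1:
  fixes \<rho> :: "real^'n \<Rightarrow> real"
  assumes "CARD('n) = 1"
  shows "reduced_kernel \<rho> k w = \<rho> (vec w)"
proof -
  have all: "i = k" for i :: 'n
    using assms by (metis UNIV_I card_1_singletonE singletonD)
  then have e: "UNIV - {k} = {}" by auto
  have "(\<chi> i. if i = k then w else p i) = (vec w :: real^'n)" for p
    using all by (simp add: vec_eq_iff)
  then show ?thesis
    unfolding reduced_kernel_def e PiM_empty
    by (simp add: lebesgue_integral_count_space_finite)
qed

definition modulus_of_continuity_on ::
  "'a::real_normed_vector set \<Rightarrow> (real \<Rightarrow> real) \<Rightarrow> ('a \<Rightarrow> real) \<Rightarrow> bool" where
  "modulus_of_continuity_on \<Omega> \<omega> f \<longleftrightarrow>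
     (\<forall>r\<ge>0. 0 \<le> \<omega> r) \<and>
     continuous (at 0 within {0..}) \<omega> \<and>
     \<omega> 0 = 0 \<and>
     (\<forall>x\<in>\<Omega>. \<forall>y\<in>\<Omega>. \<bar>f y - f x\<bar> \<le> 2 * \<omega> (norm (y - x) / 2))"

definition odd_extension :: "(real \<Rightarrow> real \<Rightarrow> real) \<Rightarrow> real \<Rightarrow> real \<Rightarrow> real" where
  "odd_extension \<phi> r t = (if r \<ge> 0 then \<phi> r t else - \<phi> (- r) t)"

text \<open>\<open>C\<^sup>m\<close> functions on the whole space: all iterated directional derivatives up to order \<open>m\<close>
  exist (as values of Frechet derivatives) and those of order \<open>m\<close> are continuous.\<close>

primrec C_diff :: "nat \<Rightarrow> ('a::real_normed_vector \<Rightarrow> real) \<Rightarrow> bool" where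
  "C_diff 0 f \<longleftrightarrow> continuous_on UNIV f"
| "C_diff (Suc m) f \<longleftrightarrow>
     (\<forall>x. f differentiable (at x)) \<and> (\<forall>v. C_diff m (\<lambda>x. frechet_derivative f (at x) v))"

definition smooth :: "('a::real_normed_vector \<Rightarrow> real) \<Rightarrow> bool" where
  "smooth f \<longleftrightarrow> (\<forall>m. C_diff m f)"

end

theory Submission
  imports Defs
begin

text \<open>The proof is a maximum principle on pairs of points. Let \<open>K \<ge> 0\<close> bound the operator applied
  to \<open>\<Psi>\<close> from above and, for \<open>\<epsilon> > 0\<close>, consider the two-point function

    \<open>Z (x, y) t = u y t - u x t - 2 * \<phi> (\<bar>y - x\<bar> / 2) t - \<epsilon> * exp ((K + 1) * t) * (\<Psi> x + \<Psi> y)\<close>.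

  It is negative at \<open>t = 0\<close>. Since \<open>u\<close> is bounded and \<open>\<Psi>\<close> tends to infinity, it is negative
  outside a compact set of pairs, so if it ever reached \<open>0\<close> there would be a first time \<open>t\<close> and
  a pair \<open>(x, y)\<close> where this happens (lemma \<open>first_contact\<close>). The pair is off the diagonal, and
  the time derivative of \<open>Z\<close> there is non-negative. But the two evolution equations
  and the choice of the penalty make it negative.

  The contradiction comes from the reflection coupling. Let \<open>R\<close> be the reflection in the
  hyperplane that perpendicularly bisects the segment from \<open>x\<close> to \<open>y\<close>, and \<open>d\<close> the signed
  distance to it, with \<open>d y = \<bar>y - x\<bar> / 2\<close>. Mapping the integral around \<open>x\<close> by \<open>R\<close> to one
  around \<open>y\<close> expresses the difference of the operator applied to \<open>u\<close> at \<open>y\<close> and at \<open>x\<close>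
  through the increments
  \<open>u z - u (R z)\<close>. As \<open>Z\<close> is at most \<open>0\<close> at the pair \<open>(R z, z)\<close>, such an increment is at most
  \<open>2 * \<phi> (d z) t\<close> plus the penalty whenever \<open>d z \<ge> 0\<close>. This half of the space is enough
  because the kernel is radially non-increasing
  (lemma \<open>reflection_coupling_integral_le\<close>). The function \<open>z \<mapsto> odd_extension \<phi> (d z) t\<close> is a plane
  wave, and on plane waves the operator reduces to the one-dimensional one with the marginal kernel
  (lemma \<open>integral_directional\<close>). So the contribution of \<open>\<phi>\<close> cancels against its own equation
  (lemma \<open>nonlocal_op_difference_le\<close>), and what remains is the penalty: it contributes at most \<open>2 * K\<close>
  times \<open>\<epsilon> * exp ((K + 1) * t)\<close> through the operator, but its own growth takes away at least
  \<open>2 * (K + 1)\<close> times that. Hence \<open>Z < 0\<close> for all times, and \<open>\<epsilon> \<rightarrow> 0\<close> gives the claim.\<close>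

section \<open>Lebesgue integrals under isometries\<close>

lemma nn_integral_lborel_translate:
  fixes g :: "'a::euclidean_space \<Rightarrow> ennreal"
  assumes [measurable]: "g \<in> borel_measurable borel"
  shows "(\<integral>\<^sup>+x. g (a + x) \<partial>lborel) = (\<integral>\<^sup>+x. g x \<partial>lborel)"
proof -
  have "(\<integral>\<^sup>+x. g x \<partial>lborel) = (\<integral>\<^sup>+x. g x \<partial>distr lborel borel ((+) a))"
    by (simp only: lborel_distr_plus)
  also have "\<dots> = (\<integral>\<^sup>+x. g (a + x) \<partial>lborel)"
    by (subst nn_integral_distr) auto
  finally show ?thesis ..
qed

text \<open>Let \<open>b\<close> be the indicator of the unit ball. In the double integral of \<open>g (f x) * b y\<close> the
  translation \<open>y \<mapsto> y - f x\<close>, then the translation of \<open>x\<close> by a preimage of \<open>y\<close> under \<open>f\<close>, turn the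
  integrand into \<open>g (f x + y) * b (- f x)\<close>. Since \<open>b (- f x) = b x\<close>, one more translation removes
  \<open>f\<close> altogether, and the positive finite factor \<open>\<integral> b\<close> cancels. This is the uniqueness argument
  for Haar measure.\<close>

lemma nn_integral_lborel_orthogonal:
  fixes f :: "'a::euclidean_space \<Rightarrow> 'a" and g :: "'a \<Rightarrow> ennreal"
  assumes f: "orthogonal_transformation f" and [measurable]: "g \<in> borel_measurable borel"
  shows "(\<integral>\<^sup>+x. g (f x) \<partial>lborel) = (\<integral>\<^sup>+x. g x \<partial>lborel)"
proof -
  define b :: "'a \<Rightarrow> ennreal" where "b = indicator (ball 0 1)"
  have lin: "linear f" using f by (rule orthogonal_transformation_linear)
  have [measurable]: "f \<in> borel_measurable borel"
    using lin by (intro borel_measurable_continuous_onI linear_continuous_on linear_conv_bounded_linear[THEN iffD1])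
  have [measurable]: "b \<in> borel_measurable borel" unfolding b_def by (rule borel_measurable_indicator) simp
  have norm_f: "norm (f x) = norm x" for x
    using f by (simp add: orthogonal_transformation)
  have b_f: "b (- f x) = b x" for x by (auto simp: b_def indicator_def norm_f)
  have "(\<integral>\<^sup>+x. g (f x) \<partial>lborel) * (\<integral>\<^sup>+y. b y \<partial>lborel)
      = (\<integral>\<^sup>+x. (\<integral>\<^sup>+y. g (f x) * b y \<partial>lborel) \<partial>lborel)"
    by (simp add: nn_integral_cmult nn_integral_multc)
  also have "\<dots> = (\<integral>\<^sup>+x. (\<integral>\<^sup>+y. g (f x) * b (- f x + y) \<partial>lborel) \<partial>lborel)"
    by (intro nn_integral_cong nn_integral_lborel_translate[symmetric]) simp
  also have "\<dots> = (\<integral>\<^sup>+y. (\<integral>\<^sup>+x. g (f x) * b (- f x + y) \<partial>lborel) \<partial>lborel)"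
    by (rule lborel_pair.Fubini'[symmetric]) simp
  also have "\<dots> = (\<integral>\<^sup>+y. (\<integral>\<^sup>+x. g (f x + y) * b x \<partial>lborel) \<partial>lborel)"
  proof (rule nn_integral_cong)
    fix y
    obtain y' where y': "y = f y'"
      using orthogonal_transformation_surj[OF f] by (metis surjD)
    have "(\<integral>\<^sup>+x. g (f x) * b (- f x + y) \<partial>lborel)
        = (\<integral>\<^sup>+x. g (f (y' + x)) * b (- f (y' + x) + y) \<partial>lborel)"
      by (rule nn_integral_lborel_translate[symmetric]) simp
    then show "(\<integral>\<^sup>+x. g (f x) * b (- f x + y) \<partial>lborel) = (\<integral>\<^sup>+x. g (f x + y) * b x \<partial>lborel)"
      by (simp add: y' linear_add[OF lin] b_f add.commute)
  qed
  also have "\<dots> = (\<integral>\<^sup>+x. (\<integral>\<^sup>+y. g (f x + y) * b x \<partial>lborel) \<partial>lborel)"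
    by (rule lborel_pair.Fubini') simp
  also have "\<dots> = (\<integral>\<^sup>+x. g x \<partial>lborel) * (\<integral>\<^sup>+y. b y \<partial>lborel)"
    by (simp add: nn_integral_cmult nn_integral_multc nn_integral_lborel_translate)
  finally have *: "(\<integral>\<^sup>+x. g (f x) \<partial>lborel) * (\<integral>\<^sup>+y. b y \<partial>lborel)
      = (\<integral>\<^sup>+x. g x \<partial>lborel) * (\<integral>\<^sup>+y. b y \<partial>lborel)" .
  have b_int: "(\<integral>\<^sup>+y. b y \<partial>lborel) = emeasure lborel (ball (0::'a) 1)"
    by (simp add: b_def)
  have "emeasure lborel (ball (0::'a) 1) \<noteq> 0"
  proof
    assume "emeasure lborel (ball (0::'a) 1) = 0"
    then have "negligible (ball (0::'a) 1)"
      by (simp add: negligible_iff_null_sets null_sets_def)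
    then show False using open_not_negligible[of "ball (0::'a) 1"] by simp
  qed
  moreover have "emeasure lborel (ball (0::'a) 1) \<noteq> top"
    using emeasure_bounded_finite[of "ball (0::'a) 1"] by simp
  ultimately show ?thesis using * unfolding b_int
    by (metis ennreal_mult_divide_eq)
qed

lemma lborel_distr_orthogonal:
  fixes f :: "'a::euclidean_space \<Rightarrow> 'a"
  assumes f: "orthogonal_transformation f"
  shows "distr lborel borel (\<lambda>x. a + f x) = lborel"
proof (rule measure_eqI)
  have [measurable]: "f \<in> borel_measurable borel"
    using orthogonal_transformation_linear[OF f]
    by (intro borel_measurable_continuous_onI linear_continuous_on linear_conv_bounded_linear[THEN iffD1])
  fix A assume "A \<in> sets (distr lborel borel (\<lambda>x. a + f x))"
  then have [measurable]: "A \<in> sets borel" by simp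
  have "emeasure (distr lborel borel (\<lambda>x. a + f x)) A = (\<integral>\<^sup>+x. indicator A (a + f x) \<partial>lborel)"
    by (simp add: nn_integral_distr flip: nn_integral_indicator)
  also have "\<dots> = (\<integral>\<^sup>+x. indicator A (a + x) \<partial>lborel)"
    by (rule nn_integral_lborel_orthogonal[OF f, of "\<lambda>x. indicator A (a + x)"]) simp
  also have "\<dots> = emeasure lborel A"
    by (subst nn_integral_lborel_translate) simp_all
  finally show "emeasure (distr lborel borel (\<lambda>x. a + f x)) A = emeasure lborel A" .
qed simp

text \<open>The isometry is given by the values of \<open>T\<close> rather than as a composite, so that the rules apply
  to a \<open>T\<close> with its own definition, such as a reflection in a hyperplane.\<close>

lemma
  fixes f :: "'a::euclidean_space \<Rightarrow> 'a" and h :: "'a \<Rightarrow> real"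
  assumes f: "orthogonal_transformation f" and T: "\<And>z. T z = a + f z"
    and h: "h \<in> borel_measurable borel"
  shows integral_lborel_isometry: "(\<integral>z. h (T z) \<partial>lborel) = (\<integral>z. h z \<partial>lborel)"
    and integrable_lborel_isometry: "integrable lborel (\<lambda>z. h (T z)) \<longleftrightarrow> integrable lborel h"
proof -
  have "linear f" using f by (rule orthogonal_transformation_linear)
  then have "f \<in> borel_measurable borel"
    by (intro borel_measurable_continuous_onI linear_continuous_on linear_conv_bounded_linear[THEN iffD1])
  then have meas: "T \<in> borel_measurable lborel" unfolding T[abs_def] by simp
  have T': "distr lborel borel T = lborel"
    unfolding T[abs_def] by (rule lborel_distr_orthogonal[OF f])
  show "(\<integral>z. h (T z) \<partial>lborel) = (\<integral>z. h z \<partial>lborel)"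
    using integral_distr[OF meas h] by (simp add: T')
  show "integrable lborel (\<lambda>z. h (T z)) \<longleftrightarrow> integrable lborel h"
    using integrable_distr_eq[OF meas h] by (simp add: T')
qed

lemma integrable_translate:
  fixes f :: "'a::euclidean_space \<Rightarrow> real"
  assumes "integrable lborel f"
  shows "integrable lborel (\<lambda>z. f (z - a))"
  using assms integrable_lborel_isometry[OF orthogonal_transformation_id[where 'a='a], of "\<lambda>z. z - a" "- a" f]
  by (simp add: integrable_iff_bounded)

lemma integral_translate:
  fixes f :: "'a::euclidean_space \<Rightarrow> real"
  assumes "integrable lborel f"
  shows "(\<integral>z. f (z - a) \<partial>lborel) = (\<integral>z. f z \<partial>lborel)"
  using assms integral_lborel_isometry[OF orthogonal_transformation_id[where 'a='a], of "\<lambda>z. z - a" "- a" f]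
  by (simp add: integrable_iff_bounded)

lemma integrable_mult_bounded:
  fixes f h :: "'a::euclidean_space \<Rightarrow> real"
  assumes f: "integrable lborel f" and h: "h \<in> borel_measurable borel" and B: "\<And>z. \<bar>h z\<bar> \<le> B"
  shows "integrable lborel (\<lambda>z. f z * h z)"
proof (rule Bochner_Integration.integrable_bound)
  show "integrable lborel (\<lambda>z. B * f z)" using f by simp
  show "(\<lambda>z. f z * h z) \<in> borel_measurable lborel"
    using borel_measurable_integrable[OF f] h by simp
  have "\<bar>h z\<bar> * \<bar>f z\<bar> \<le> \<bar>B\<bar> * \<bar>f z\<bar>" for z
    using B[of z] by (intro mult_right_mono) auto
  then show "AE z in lborel. norm (f z * h z) \<le> norm (B * f z)"
    by (simp add: abs_mult mult.commute)
qed

section \<open>The reduced kernel as a one-dimensional marginal\<close>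

lemma measurable_join_coordinate:
  fixes k :: "'n::finite"
  shows "(\<lambda>(w, p). (\<chi> i. if i = k then w else p i) :: real^'n)
           \<in> lborel \<Otimes>\<^sub>M (\<Pi>\<^sub>M i\<in>UNIV - {k}. (lborel :: real measure)) \<rightarrow>\<^sub>M borel"
    (is "?T \<in> lborel \<Otimes>\<^sub>M ?N \<rightarrow>\<^sub>M borel")
proof (rule borel_measurable_euclidean_space[THEN iffD2], safe)
  fix b :: "real^'n" assume "b \<in> Basis"
  then obtain j where b: "b = axis j 1" by (auto simp: Basis_vec_def)
  have "(\<lambda>x. snd x j) \<in> borel_measurable (lborel \<Otimes>\<^sub>M ?N)" if "j \<noteq> k"
    using that by (intro measurable_compose[OF measurable_snd]) simp
  then show "(\<lambda>x. ?T x \<bullet> b) \<in> borel_measurable (lborel \<Otimes>\<^sub>M ?N)"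
    by (cases "j = k") (auto simp: b case_prod_beta inner_axis)
qed

text \<open>Both sides give a box the product of its side lengths. This puts the product measure in the
  definition of \<open>reduced_kernel\<close> within reach of Fubini's theorem.\<close>

lemma distr_lborel_split_coordinate:
  fixes k :: "'n::finite"
  shows "distr (lborel \<Otimes>\<^sub>M (\<Pi>\<^sub>M i\<in>UNIV - {k}. (lborel :: real measure))) borel
           (\<lambda>(w, p). \<chi> i. if i = k then w else p i) = (lborel :: (real^'n) measure)"
    (is "distr (lborel \<Otimes>\<^sub>M ?N) borel ?T = _")
proof (rule lborel_eqI[symmetric])
  interpret P: finite_product_sigma_finite "\<lambda>_. lborel :: real measure" "UNIV - {k}"
    by standard simp
  note T[measurable] = measurable_join_coordinate[of k]
  fix l u :: "real^'n" assume le: "\<And>b. b \<in> Basis \<Longrightarrow> l \<bullet> b \<le> u \<bullet> b"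
  have le': "l $ i \<le> u $ i" for i
    using le[of "axis i 1"] by (simp add: inner_axis)
  have "emeasure (distr (lborel \<Otimes>\<^sub>M ?N) borel ?T) (box l u)
      = emeasure (lborel \<Otimes>\<^sub>M ?N) (?T -` box l u \<inter> space (lborel \<Otimes>\<^sub>M ?N))"
    by (rule emeasure_distr) auto
  also have "?T -` box l u \<inter> space (lborel \<Otimes>\<^sub>M ?N)
      = {l $ k<..<u $ k} \<times> (\<Pi>\<^sub>E i\<in>UNIV - {k}. {l $ i<..<u $ i})"
  proof -
    have "?T (w, p) \<in> box l u \<longleftrightarrow>
        w \<in> {l $ k<..<u $ k} \<and> (\<forall>i\<in>UNIV - {k}. p i \<in> {l $ i<..<u $ i})" for w p
      by (auto simp: mem_box_cart)
    then show ?thesis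
      by (auto simp: space_pair_measure space_PiM PiE_iff simp del: greaterThanLessThan_iff)
  qed
  also have "emeasure (lborel \<Otimes>\<^sub>M ?N) \<dots>
      = emeasure lborel {l $ k<..<u $ k} * (\<Prod>i\<in>UNIV - {k}. emeasure lborel {l $ i<..<u $ i})"
    by (subst P.emeasure_pair_measure_Times) (auto simp: P.measure_times intro!: sets_PiM_I_finite)
  also have "\<dots> = (\<Prod>i\<in>UNIV. ennreal (u $ i - l $ i))"
    using le' by (subst prod.remove[of UNIV k]) auto
  also have "\<dots> = ennreal (\<Prod>i\<in>UNIV. (u - l) $ i)"
    using le' by (simp add: prod_ennreal)
  also have "(\<Prod>i\<in>UNIV. (u - l) $ i) = (\<Prod>b\<in>Basis. (u - l) \<bullet> b)"
    by (simp add: Basis_vec_def UNION_singleton_eq_range prod.reindex inj_on_def axis_eq_axis inner_axis)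
  finally show "emeasure (distr (lborel \<Otimes>\<^sub>M ?N) borel ?T) (box l u)
      = ennreal (\<Prod>b\<in>Basis. (u - l) \<bullet> b)" .
qed simp

lemma integral_reduced_kernel:
  fixes \<rho> :: "real^'n \<Rightarrow> real" and g :: "real \<Rightarrow> real"
  assumes int: "integrable lborel (\<lambda>z. \<rho> z * g (z $ k))"
  shows "(\<integral>w. reduced_kernel \<rho> k w * g w \<partial>lborel) = (\<integral>z. \<rho> z * g (z $ k) \<partial>lborel)"
proof -
  interpret P: finite_product_sigma_finite "\<lambda>_. lborel :: real measure" "UNIV - {k}"
    by standard simp
  let ?N = "\<Pi>\<^sub>M i\<in>UNIV - {k}. (lborel :: real measure)"
  let ?T = "\<lambda>(w, p). (\<chi> i. if i = k then w else p i) :: real^'n"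
  let ?F = "\<lambda>z. \<rho> z * g (z $ k)"
  interpret Q: pair_sigma_finite lborel ?N ..
  have F: "?F \<in> borel_measurable borel"
    using int by (simp add: integrable_iff_bounded)
  have intT: "integrable (lborel \<Otimes>\<^sub>M ?N) (\<lambda>x. ?F (?T x))"
    using int by (subst integrable_distr_eq[symmetric, OF measurable_join_coordinate F])
      (simp add: distr_lborel_split_coordinate)
  have "(\<integral>z. ?F z \<partial>lborel) = (\<integral>x. ?F (?T x) \<partial>(lborel \<Otimes>\<^sub>M ?N))"
    by (subst distr_lborel_split_coordinate[symmetric, of k])
      (rule integral_distr[OF measurable_join_coordinate F])
  also have "\<dots> = (\<integral>w. (\<integral>p. ?F (?T (w, p)) \<partial>?N) \<partial>lborel)"
    by (rule Q.integral_fst'[OF intT, symmetric])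
  also have "\<dots> = (\<integral>w. reduced_kernel \<rho> k w * g w \<partial>lborel)"
    by (simp add: reduced_kernel_def)
  finally show ?thesis ..
qed

text \<open>By radial symmetry every direction has the same marginal: an orthogonal map taking the \<open>k\<close>-th
  axis to \<open>e\<close> preserves both \<open>\<rho>\<close> and Lebesgue measure. Thus the one-dimensional operator acting on
  \<open>g\<close> is the \<open>n\<close>-dimensional operator acting on the plane wave \<open>z \<mapsto> g (z \<bullet> e)\<close>.\<close>

lemma integral_directional:
  fixes \<rho> :: "real^'n \<Rightarrow> real" and g :: "real \<Rightarrow> real"
  assumes rho: "integrable lborel \<rho>" and sym: "radially_symmetric \<rho>"
    and g: "g \<in> borel_measurable borel" and B: "\<And>s. \<bar>g s\<bar> \<le> B"
    and e: "norm e = 1"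
  shows "(\<integral>z. \<rho> (z - y) * g ((z - y) \<bullet> e) \<partial>lborel) = (\<integral>w. reduced_kernel \<rho> k w * g w \<partial>lborel)"
proof -
  obtain f :: "real^'n \<Rightarrow> real^'n" where f: "orthogonal_transformation f" and fk: "f (axis k 1) = e"
    using orthogonal_transformation_exists_1[of "axis k 1" e] e by auto
  have rho_f: "\<rho> (f z) = \<rho> z" for z
    using sym f unfolding radially_symmetric_def orthogonal_transformation by blast
  have f_e: "f z \<bullet> e = z $ k" for z
    using f fk by (metis orthogonal_transformation_def cart_eq_inner_axis)
  have [measurable]: "\<rho> \<in> borel_measurable borel" using rho by (simp add: integrable_iff_bounded)
  note g[measurable]
  have "(\<integral>z. \<rho> (z - y) * g ((z - y) \<bullet> e) \<partial>lborel)
      = (\<integral>z. \<rho> (y + f z - y) * g ((y + f z - y) \<bullet> e) \<partial>lborel)"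
    by (rule integral_lborel_isometry[OF f, symmetric]) auto
  also have "\<dots> = (\<integral>z. \<rho> z * g (z $ k) \<partial>lborel)"
    by (simp add: rho_f f_e)
  also have "\<dots> = (\<integral>w. reduced_kernel \<rho> k w * g w \<partial>lborel)"
    by (rule integral_reduced_kernel[symmetric], rule integrable_mult_bounded[OF rho _ B]) simp
  finally show ?thesis .
qed

section \<open>Reflection in the midplane of two points\<close>

text \<open>The sign is chosen so that \<open>y\<close> lies on the positive side of the hyperplane that perpendicularly
  bisects the segment from \<open>x\<close> to \<open>y\<close>.\<close>

definition midplane_dist :: "'a::real_inner \<Rightarrow> 'a \<Rightarrow> 'a \<Rightarrow> real" where
  "midplane_dist x y z = (z - (1/2) *\<^sub>R (x + y)) \<bullet> sgn (y - x)"

definition midplane_reflection :: "'a::real_inner \<Rightarrow> 'a \<Rightarrow> 'a \<Rightarrow> 'a" where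
  "midplane_reflection x y z = z - (2 * midplane_dist x y z) *\<^sub>R sgn (y - x)"

lemma orthogonal_transformation_householder:
  fixes e :: "'a::real_inner"
  assumes "norm e = 1"
  shows "orthogonal_transformation (\<lambda>z. z - (2 * (z \<bullet> e)) *\<^sub>R e)"
proof -
  have "e \<bullet> e = 1" using assms by (simp add: norm_eq_1)
  then show ?thesis
    unfolding orthogonal_transformation_def
    by (auto intro!: linearI simp: inner_simps algebra_simps inner_commute)
qed

context
  fixes x y :: "'a::euclidean_space"
  assumes xy: "x \<noteq> y"
begin

private lemma norm_e: "norm (sgn (y - x)) = 1"
  using xy by (simp add: norm_sgn)

private lemma inner_e: "sgn (y - x) \<bullet> sgn (y - x) = 1"
  using norm_e by (simp add: norm_eq_1)

private lemma diff_eq: "y - x = norm (y - x) *\<^sub>R sgn (y - x)"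
  using xy by (simp add: sgn_div_norm)

lemma midplane_reflection_affine:
  "midplane_reflection x y z
   = ((x + y) \<bullet> sgn (y - x)) *\<^sub>R sgn (y - x) + (z - (2 * (z \<bullet> sgn (y - x))) *\<^sub>R sgn (y - x))"
  by (simp add: midplane_reflection_def midplane_dist_def inner_simps algebra_simps)

lemma midplane_dist_reflection: "midplane_dist x y (midplane_reflection x y z) = - midplane_dist x y z"
proof -
  have "midplane_dist x y (midplane_reflection x y z)
      = midplane_dist x y z - 2 * midplane_dist x y z * (sgn (y - x) \<bullet> sgn (y - x))"
    unfolding midplane_reflection_def by (subst (1 2) midplane_dist_def) (simp add: inner_simps)
  then show ?thesis by (simp add: inner_e)
qed

lemma midplane_reflection_reflection: "midplane_reflection x y (midplane_reflection x y z) = z"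
  by (subst midplane_reflection_def)
     (simp add: midplane_dist_reflection, simp add: midplane_reflection_def)

lemma midplane_dist_eq: "midplane_dist x y z = (z - y) \<bullet> sgn (y - x) + norm (y - x) / 2"
proof -
  have "z - (1/2) *\<^sub>R (x + y) = (z - y) + (1/2) *\<^sub>R (y - x)"
    by (simp add: algebra_simps flip: scaleR_left_distrib)
  then have "midplane_dist x y z = (z - y) \<bullet> sgn (y - x) + (1/2) * ((y - x) \<bullet> sgn (y - x))"
    by (simp only: midplane_dist_def inner_add_left inner_scaleR_left)
  also have "(y - x) \<bullet> sgn (y - x) = norm (y - x)"
    by (subst (1) diff_eq) (simp add: inner_e)
  finally show ?thesis by simp
qed

lemma midplane_reflection_endpoint: "midplane_reflection x y y = x"
  using diff_eq by (simp add: midplane_reflection_def midplane_dist_eq)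

lemma norm_midplane_reflection_diff:
  "norm (midplane_reflection x y z - midplane_reflection x y w) = norm (z - w)"
proof -
  have "midplane_reflection x y z - midplane_reflection x y w
      = (z - w) - (2 * ((z - w) \<bullet> sgn (y - x))) *\<^sub>R sgn (y - x)"
    by (simp add: midplane_reflection_affine inner_simps algebra_simps)
  then show ?thesis
    using orthogonal_transformation_householder[OF norm_e] by (simp add: orthogonal_transformation)
qed

lemma norm_diff_midplane_reflection: "norm (z - midplane_reflection x y z) = 2 * \<bar>midplane_dist x y z\<bar>"
  by (simp add: midplane_reflection_def norm_e)

text \<open>Of the two points, \<open>y\<close> is the closer one exactly on the positive side. A radially
  non-increasing kernel therefore puts more weight around \<open>y\<close> than around \<open>x\<close> on that side.\<close>

lemma norm_power2_diff_midplane: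
  "norm (z - x) ^ 2 - norm (z - y) ^ 2 = 2 * norm (y - x) * midplane_dist x y z"
proof -
  define a L e where "a = z - y" and "L = norm (y - x)" and "e = sgn (y - x)"
  have zx: "z - x = a + L *\<^sub>R e"
    using diff_eq by (simp add: a_def L_def e_def)
  have ee: "e \<bullet> e = 1" by (simp add: e_def inner_e)
  have "norm (z - x) ^ 2 = a \<bullet> a + 2 * L * (a \<bullet> e) + L ^ 2"
    unfolding zx power2_norm_eq_inner
    by (simp add: inner_simps ee inner_commute power2_eq_square)
  moreover have "norm (z - y) ^ 2 = a \<bullet> a" by (simp add: a_def power2_norm_eq_inner)
  moreover have "midplane_dist x y z = a \<bullet> e + L / 2"
    by (simp add: midplane_dist_eq a_def L_def e_def)
  ultimately show ?thesis
    by (simp add: algebra_simps power2_eq_square flip: L_def)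
qed

lemma midplane_closer:
  assumes "0 \<le> midplane_dist x y z"
  shows "norm (z - y) \<le> norm (z - x)"
proof -
  have "0 \<le> 2 * norm (y - x) * midplane_dist x y z" using assms by simp
  then show ?thesis
    using norm_power2_diff_midplane[of z] by (smt (verit) power2_le_imp_le norm_ge_zero)
qed

lemma midplane_farther:
  assumes "midplane_dist x y z \<le> 0"
  shows "norm (z - x) \<le> norm (z - y)"
proof -
  have "2 * norm (y - x) * midplane_dist x y z \<le> 0" using assms by (simp add: mult_nonneg_nonpos)
  then show ?thesis
    using norm_power2_diff_midplane[of z] by (smt (verit) power2_le_imp_le norm_ge_zero)
qed

lemma integral_midplane_reflection:
  fixes h :: "'a \<Rightarrow> real"
  assumes "h \<in> borel_measurable borel"
  shows "(\<integral>z. h (midplane_reflection x y z) \<partial>lborel) = (\<integral>z. h z \<partial>lborel)"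
  by (rule integral_lborel_isometry[OF orthogonal_transformation_householder[OF norm_e]
        midplane_reflection_affine assms])

lemma integrable_midplane_reflection:
  fixes h :: "'a \<Rightarrow> real"
  assumes "h \<in> borel_measurable borel"
  shows "integrable lborel (\<lambda>z. h (midplane_reflection x y z)) \<longleftrightarrow> integrable lborel h"
  by (rule integrable_lborel_isometry[OF orthogonal_transformation_householder[OF norm_e]
        midplane_reflection_affine assms])

lemma measurable_midplane_reflection: "midplane_reflection x y \<in> borel_measurable borel"
  unfolding midplane_reflection_def[abs_def] midplane_dist_def by measurable

lemma kernel_midplane_reflection:
  assumes "radially_symmetric \<rho>"
  shows "\<rho> (midplane_reflection x y z - y) = \<rho> (z - x)"
proof -
  have "midplane_reflection x y x = y"
    using midplane_reflection_reflection[of y] by (simp add: midplane_reflection_endpoint)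
  then have "norm (midplane_reflection x y z - y) = norm (z - x)"
    using norm_midplane_reflection_diff[of z x] by simp
  then show ?thesis using assms unfolding radially_symmetric_def by blast
qed

text \<open>An upper bound for \<open>F\<close> on the positive side says nothing about its size on the other, yet the
  integral runs over the whole space. By oddness, \<open>\<integral> \<rho> (z - x) * F z = - \<integral> \<rho> (z - y) * F z\<close>, so
  twice the left-hand side is the integral of \<open>(\<rho> (z - y) - \<rho> (z - x)) * F z\<close>. Both factors are
  odd under the reflection, and away from \<open>y\<close> the first one is non-negative on the positive
  side by monotonicity of the kernel, so the one-sided bound is enough on both sides. The difference of
  kernels is then estimated by their sum, and \<open>G\<close>, being even, has the same integral
  against either summand.\<close>

lemma reflection_coupling_integral_le:
  fixes \<rho> F G :: "'a \<Rightarrow> real"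
  assumes rho_nonneg: "\<And>z. 0 \<le> \<rho> z"
    and sym: "radially_symmetric \<rho>" and mono: "radially_nonincreasing \<rho>"
    and rho_meas: "\<rho> \<in> borel_measurable borel"
    and F_meas: "F \<in> borel_measurable borel" and G_meas: "G \<in> borel_measurable borel"
    and F_int: "integrable lborel (\<lambda>z. \<rho> (z - y) * F z)"
    and G_int: "integrable lborel (\<lambda>z. \<rho> (z - y) * G z)"
    and F_odd: "\<And>z. F (midplane_reflection x y z) = - F z"
    and G_even: "\<And>z. G (midplane_reflection x y z) = G z"
    and G_nonneg: "\<And>z. 0 \<le> G z"
    and FG: "\<And>z. 0 \<le> midplane_dist x y z \<Longrightarrow> F z \<le> G z"
  shows "(\<integral>z. \<rho> (z - y) * F z \<partial>lborel) \<le> (\<integral>z. \<rho> (z - y) * G z \<partial>lborel)"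
proof -
  note [measurable] = rho_meas F_meas G_meas
  let ?R = "midplane_reflection x y"
  have rho_R: "\<rho> (?R z - y) = \<rho> (z - x)" for z
    by (rule kernel_midplane_reflection[OF sym])
  have F_int': "integrable lborel (\<lambda>z. \<rho> (z - x) * F z)"
    using integrable_midplane_reflection[of "\<lambda>z. \<rho> (z - y) * F z"] F_int
    by (simp add: rho_R F_odd)
  have G_int': "integrable lborel (\<lambda>z. \<rho> (z - x) * G z)"
    using integrable_midplane_reflection[of "\<lambda>z. \<rho> (z - y) * G z"] G_int
    by (simp add: rho_R G_even)
  have F_eq: "(\<integral>z. \<rho> (z - x) * F z \<partial>lborel) = - (\<integral>z. \<rho> (z - y) * F z \<partial>lborel)"
    using integral_midplane_reflection[of "\<lambda>z. \<rho> (z - y) * F z"]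
    by (simp add: rho_R F_odd)
  have G_eq: "(\<integral>z. \<rho> (z - x) * G z \<partial>lborel) = (\<integral>z. \<rho> (z - y) * G z \<partial>lborel)"
    using integral_midplane_reflection[of "\<lambda>z. \<rho> (z - y) * G z"]
    by (simp add: rho_R G_even)
  \<comment> \<open>Monotonicity gives no comparison with \<open>\<rho> 0\<close>, hence the two excluded points.\<close>
  have pointwise: "\<rho> (z - y) * F z - \<rho> (z - x) * F z \<le> \<rho> (z - y) * G z + \<rho> (z - x) * G z"
    if "z \<noteq> x" "z \<noteq> y" for z
  proof (cases "0 \<le> midplane_dist x y z")
    case True
    then have "\<rho> (z - x) \<le> \<rho> (z - y)"
      using mono that midplane_closer[OF True] by (auto simp: radially_nonincreasing_def)
    then have "(\<rho> (z - y) - \<rho> (z - x)) * F z \<le> (\<rho> (z - y) - \<rho> (z - x)) * G z"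
      using FG[OF True] by (intro mult_left_mono) auto
    moreover have "0 \<le> \<rho> (z - x) * G z" using rho_nonneg G_nonneg by simp
    ultimately show ?thesis by (simp add: algebra_simps)
  next
    case False
    then have "\<rho> (z - y) \<le> \<rho> (z - x)"
      using mono that midplane_farther[of z] by (auto simp: radially_nonincreasing_def)
    moreover have "- F z \<le> G z"
      using FG[of "?R z"] False by (simp add: midplane_dist_reflection F_odd G_even)
    ultimately have "(\<rho> (z - x) - \<rho> (z - y)) * (- F z) \<le> (\<rho> (z - x) - \<rho> (z - y)) * G z"
      by (intro mult_left_mono) auto
    moreover have "0 \<le> \<rho> (z - y) * G z" using rho_nonneg G_nonneg by simp
    ultimately show ?thesis by (simp add: algebra_simps)
  qed
  have "(\<integral>z. \<rho> (z - y) * F z - \<rho> (z - x) * F z \<partial>lborel)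
      \<le> (\<integral>z. \<rho> (z - y) * G z + \<rho> (z - x) * G z \<partial>lborel)"
  proof (rule integral_mono_AE)
    show "AE z in lborel. \<rho> (z - y) * F z - \<rho> (z - x) * F z \<le> \<rho> (z - y) * G z + \<rho> (z - x) * G z"
      using AE_lborel_singleton[of x] AE_lborel_singleton[of y] by eventually_elim (rule pointwise)
  qed (use F_int F_int' G_int G_int' in auto)
  then show ?thesis
    using F_int F_int' G_int G_int' by (simp add: F_eq G_eq)
qed

end

section \<open>The comparison inequality at a point of contact\<close>

lemma nonlocal_op_eq:
  fixes \<rho> :: "real^'n \<Rightarrow> real"
  assumes rho: "integrable lborel \<rho>" and h: "integrable lborel (\<lambda>z. \<rho> (z - x) * h z)"
  shows "nonlocal_op \<rho> h x = (\<integral>z. \<rho> (z - x) * h z \<partial>lborel) - (\<integral>z. \<rho> z \<partial>lborel) * h x"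
proof -
  have "nonlocal_op \<rho> h x = (\<integral>z. \<rho> (z - x) * h z - \<rho> (z - x) * h x \<partial>lborel)"
    by (simp add: nonlocal_op_def right_diff_distrib)
  also have "\<dots> = (\<integral>z. \<rho> (z - x) * h z \<partial>lborel) - (\<integral>z. \<rho> (z - x) * h x \<partial>lborel)"
    using h integrable_translate[OF rho] by (intro Bochner_Integration.integral_diff) auto
  also have "(\<integral>z. \<rho> (z - x) * h x \<partial>lborel) = (\<integral>z. \<rho> z \<partial>lborel) * h x"
    using integral_translate[OF rho, of x] by simp
  finally show ?thesis .
qed

text \<open>At a pair where \<open>u y - u x\<close> touches its barrier, the terms of the two operators that do not
  involve an integral cancel, and the integrals are compared by the reflection coupling with
  \<open>F z = u z - u (R z) - 2 * g (d z)\<close> and \<open>G z = \<delta> * (\<Psi> (R z) + \<Psi> z)\<close>, where \<open>R\<close> is the reflection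
  in the midplane and \<open>d\<close> the signed distance to it. The hypothesis \<open>below\<close> is applied
  to mirror pairs, whose distance is \<open>2 * \<bar>d z\<bar>\<close>; on the positive side the barrier is then
  exactly \<open>2 * g (d z)\<close>, and oddness of \<open>g\<close> makes \<open>F\<close> odd.\<close>

lemma nonlocal_op_difference_le:
  fixes \<rho> u \<Psi> :: "real^'n \<Rightarrow> real" and g :: "real \<Rightarrow> real"
  assumes rho: "integrable lborel \<rho>" and rho_nonneg: "\<And>z. 0 \<le> \<rho> z"
    and sym: "radially_symmetric \<rho>" and mono: "radially_nonincreasing \<rho>"
    and u_meas: "u \<in> borel_measurable borel" and u_bound: "\<And>z. \<bar>u z\<bar> \<le> A"
    and g_meas: "g \<in> borel_measurable borel" and g_bound: "\<And>s. \<bar>g s\<bar> \<le> B"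
    and g_odd: "\<And>s. g (- s) = - g s"
    and Psi_meas: "\<Psi> \<in> borel_measurable borel" and Psi_nonneg: "\<And>z. 0 \<le> \<Psi> z"
    and Psi_int: "\<And>a. integrable lborel (\<lambda>z. \<rho> (z - a) * (\<Psi> z - \<Psi> a))"
    and xy: "x \<noteq> y" and \<delta>: "0 \<le> \<delta>"
    and below: "\<And>z w. u z - u w \<le> 2 * g (norm (z - w) / 2) + \<delta> * (\<Psi> w + \<Psi> z)"
    and contact: "u y - u x = 2 * g (norm (y - x) / 2) + \<delta> * (\<Psi> x + \<Psi> y)"
  shows "nonlocal_op \<rho> u y - nonlocal_op \<rho> u x
    \<le> 2 * (\<integral>w. reduced_kernel \<rho> k w * (g (norm (y - x) / 2 + w) - g (norm (y - x) / 2)) \<partial>lborel)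
      + \<delta> * (nonlocal_op \<rho> \<Psi> x + nonlocal_op \<rho> \<Psi> y)"
proof -
  let ?R = "midplane_reflection x y" and ?d = "midplane_dist x y" and ?r = "norm (y - x) / 2"
  define c where "c = (\<integral>z. \<rho> z \<partial>lborel)"
  note [measurable] = u_meas g_meas Psi_meas measurable_midplane_reflection[OF xy]
  have rho_meas[measurable]: "\<rho> \<in> borel_measurable borel" using rho by (simp add: integrable_iff_bounded)
  have d_meas[measurable]: "?d \<in> borel_measurable borel"
    unfolding midplane_dist_def[abs_def] by measurable
  have rho_R: "\<rho> (?R z - y) = \<rho> (z - x)" for z
    by (rule kernel_midplane_reflection[OF xy sym])
  have rho_R': "\<rho> (?R z - x) = \<rho> (z - y)" for z
    using rho_R[of "?R z"] midplane_reflection_reflection[OF xy] by simp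
  have int_shift: "integrable lborel (\<lambda>z. \<rho> (z - a))" for a by (rule integrable_translate[OF rho])
  have u_int: "integrable lborel (\<lambda>z. \<rho> (z - a) * u z)" for a
    by (rule integrable_mult_bounded[OF int_shift u_meas u_bound])
  have Psi_int': "integrable lborel (\<lambda>z. \<rho> (z - a) * \<Psi> z)" for a
  proof -
    have "integrable lborel (\<lambda>z. \<rho> (z - a) * (\<Psi> z - \<Psi> a) + \<rho> (z - a) * \<Psi> a)"
      using Psi_int int_shift by (intro Bochner_Integration.integrable_add) auto
    then show ?thesis by (simp add: algebra_simps)
  qed
  have gd_int: "integrable lborel (\<lambda>z. \<rho> (z - y) * g (?d z))"
    by (rule integrable_mult_bounded[OF int_shift _ g_bound]) simp
  have swap_int: "integrable lborel (\<lambda>z. \<rho> (z - y) * h (?R z))"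
    and swap: "(\<integral>z. \<rho> (z - y) * h (?R z) \<partial>lborel) = (\<integral>z. \<rho> (z - x) * h z \<partial>lborel)"
    if "\<And>a. integrable lborel (\<lambda>z. \<rho> (z - a) * h z)" "h \<in> borel_measurable borel" for h
    using integrable_midplane_reflection[OF xy, of "\<lambda>z. \<rho> (z - x) * h z"]
      integral_midplane_reflection[OF xy, of "\<lambda>z. \<rho> (z - x) * h z"] that
    by (simp_all add: rho_R')
  let ?F = "\<lambda>z. u z - u (?R z) - 2 * g (?d z)"
  let ?G = "\<lambda>z. \<delta> * (\<Psi> (?R z) + \<Psi> z)"
  have F_eq: "(\<lambda>z. \<rho> (z - y) * ?F z)
      = (\<lambda>z. \<rho> (z - y) * u z - \<rho> (z - y) * u (?R z) - 2 * (\<rho> (z - y) * g (?d z)))"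
    and G_eq: "(\<lambda>z. \<rho> (z - y) * ?G z)
      = (\<lambda>z. \<delta> * (\<rho> (z - y) * \<Psi> (?R z) + \<rho> (z - y) * \<Psi> z))"
    by (auto simp: algebra_simps)
  have "(\<integral>z. \<rho> (z - y) * ?F z \<partial>lborel) \<le> (\<integral>z. \<rho> (z - y) * ?G z \<partial>lborel)"
  proof (rule reflection_coupling_integral_le[OF xy rho_nonneg sym mono rho_meas])
    show "integrable lborel (\<lambda>z. \<rho> (z - y) * ?F z)"
      unfolding F_eq using u_int swap_int[OF u_int u_meas] gd_int by auto
    show "integrable lborel (\<lambda>z. \<rho> (z - y) * ?G z)"
      unfolding G_eq using Psi_int' swap_int[OF Psi_int' Psi_meas] by auto
    show "?F z \<le> ?G z" if "0 \<le> ?d z" for z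
      using below[of z "?R z"] norm_diff_midplane_reflection[OF xy, of z] that by simp
  qed (use Psi_nonneg \<delta> in \<open>auto simp: midplane_reflection_reflection[OF xy]
        midplane_dist_reflection[OF xy] g_odd\<close>)
  also have "(\<integral>z. \<rho> (z - y) * ?F z \<partial>lborel)
      = (\<integral>z. \<rho> (z - y) * u z \<partial>lborel) - (\<integral>z. \<rho> (z - x) * u z \<partial>lborel)
        - 2 * (\<integral>z. \<rho> (z - y) * g (?d z) \<partial>lborel)"
    unfolding F_eq using u_int swap_int[OF u_int u_meas] gd_int by (simp add: swap[OF u_int u_meas])
  also have "(\<integral>z. \<rho> (z - y) * ?G z \<partial>lborel)
      = \<delta> * ((\<integral>z. \<rho> (z - x) * \<Psi> z \<partial>lborel) + (\<integral>z. \<rho> (z - y) * \<Psi> z \<partial>lborel))"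
    unfolding G_eq using Psi_int' swap_int[OF Psi_int' Psi_meas] by (simp add: swap[OF Psi_int' Psi_meas])
  finally have coupled: "(\<integral>z. \<rho> (z - y) * u z \<partial>lborel) - (\<integral>z. \<rho> (z - x) * u z \<partial>lborel)
      - 2 * (\<integral>z. \<rho> (z - y) * g (?d z) \<partial>lborel)
    \<le> \<delta> * ((\<integral>z. \<rho> (z - x) * \<Psi> z \<partial>lborel) + (\<integral>z. \<rho> (z - y) * \<Psi> z \<partial>lborel))" .
  \<comment> \<open>On the plane wave \<open>g \<circ> d\<close> the operator at \<open>y\<close> is the one-dimensional one at \<open>d y\<close>.\<close>
  have e: "norm (sgn (y - x)) = 1" using xy by (simp add: norm_sgn)
  have "(\<integral>w. reduced_kernel \<rho> k w * (g (?r + w) - g ?r) \<partial>lborel)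
      = (\<integral>z. \<rho> (z - y) * (g (?r + (z - y) \<bullet> sgn (y - x)) - g ?r) \<partial>lborel)"
  proof (rule integral_directional[OF rho sym _ _ e, symmetric])
    show "\<bar>g (?r + s) - g ?r\<bar> \<le> 2 * B" for s
      using g_bound[of "?r + s"] g_bound[of ?r] by linarith
  qed simp
  also have "\<dots> = (\<integral>z. \<rho> (z - y) * g (?d z) - \<rho> (z - y) * g ?r \<partial>lborel)"
    by (simp add: midplane_dist_eq[OF xy] right_diff_distrib add.commute)
  also have "\<dots> = (\<integral>z. \<rho> (z - y) * g (?d z) \<partial>lborel) - (\<integral>z. \<rho> (z - y) * g ?r \<partial>lborel)"
    using gd_int int_shift by (intro Bochner_Integration.integral_diff) auto
  also have "(\<integral>z. \<rho> (z - y) * g ?r \<partial>lborel) = c * g ?r"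
    using integral_translate[OF rho, of y] by (simp add: c_def)
  finally have one_dim: "(\<integral>w. reduced_kernel \<rho> k w * (g (?r + w) - g ?r) \<partial>lborel)
      = (\<integral>z. \<rho> (z - y) * g (?d z) \<partial>lborel) - c * g ?r" .
  have "c * (u y - u x) = c * (2 * g ?r + \<delta> * (\<Psi> x + \<Psi> y))" by (simp only: contact)
  then show ?thesis
    using coupled
    unfolding one_dim nonlocal_op_eq[OF rho u_int] nonlocal_op_eq[OF rho Psi_int'] c_def[symmetric]
    by (simp add: algebra_simps)
qed

section \<open>First contact in time\<close>

lemma DERIV_nonneg_at_first_zero:
  fixes f :: "real \<Rightarrow> real"
  assumes "(f has_real_derivative D) (at t)" and "a < t"
    and "f t = 0" and "\<And>s. a \<le> s \<Longrightarrow> s < t \<Longrightarrow> f s \<le> 0"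
  shows "0 \<le> D"
proof (rule ccontr)
  assume "\<not> 0 \<le> D"
  then obtain d where d: "d > 0" "\<And>h. h > 0 \<Longrightarrow> h < d \<Longrightarrow> f t < f (t - h)"
    using DERIV_neg_dec_left[OF assms(1)] by auto
  define h where "h = min (d / 2) (t - a)"
  have "0 < h" "h < d" "a \<le> t - h" using d(1) \<open>a < t\<close> by (auto simp: h_def)
  then show False using d(2)[of h] assms(3) assms(4)[of "t - h"] by auto
qed

text \<open>The set where \<open>Z \<ge> 0\<close> is confined to a compact set of space and time, so its time coordinate
  attains a minimum. At that time \<open>Z\<close> is still \<open>\<le> 0\<close> everywhere, by continuity from earlier times,
  so the contact is an equality.\<close>

lemma first_contact:
  fixes Z :: "'a::topological_space \<Rightarrow> real \<Rightarrow> real"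
  assumes K: "compact K" and cont: "continuous_on (K \<times> {0..T}) (\<lambda>(p, t). Z p t)"
    and outside: "\<And>p t. p \<notin> K \<Longrightarrow> 0 \<le> t \<Longrightarrow> t \<le> T \<Longrightarrow> Z p t < 0"
    and init: "\<And>p. Z p 0 < 0"
    and reached: "0 \<le> T" "0 \<le> Z p1 T"
  obtains p t where "0 < t" "t \<le> T" "Z p t = 0"
    "\<And>q s. 0 \<le> s \<Longrightarrow> s < t \<Longrightarrow> Z q s < 0" "\<And>q. Z q t \<le> 0"
proof -
  define S where "S = {x \<in> K \<times> {0..T}. (case x of (p, t) \<Rightarrow> Z p t) \<in> {0..}}"
  have comp: "compact (K \<times> {0..T})" using K by (intro compact_Times) auto
  have "compact S"
  proof -
    obtain C where C: "closed C" "C \<inter> (K \<times> {0..T}) = (\<lambda>(p, t). Z p t) -` {0..} \<inter> (K \<times> {0..T})"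
      using cont unfolding continuous_on_closed_invariant by (metis closed_atLeast)
    have "S = (K \<times> {0..T}) \<inter> C" using C(2) by (auto simp: S_def)
    then show ?thesis using compact_Int_closed[OF comp C(1)] by simp
  qed
  have "p1 \<in> K" using outside[of p1 T] reached by force
  then have "S \<noteq> {}" using reached by (auto simp: S_def)
  obtain p t where pt: "(p, t) \<in> S" and least: "\<And>q s. (q, s) \<in> S \<Longrightarrow> t \<le> s"
    using continuous_attains_inf[OF \<open>compact S\<close> \<open>S \<noteq> {}\<close>, of snd] continuous_on_snd[OF continuous_on_id, of S]
    by (metis prod.collapse snd_conv)
  have p: "p \<in> K" "0 \<le> t" "t \<le> T" "0 \<le> Z p t" using pt by (auto simp: S_def)
  have before: "Z q s < 0" if "0 \<le> s" "s < t" for q s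
    using least[of q s] outside[of q s] that p by (force simp: S_def)
  have "t \<noteq> 0" using init[of p] p by auto
  have at: "Z q t \<le> 0" for q
  proof (cases "q \<in> K")
    case True
    have "continuous_on {0..T} (\<lambda>s. case (q, s) of (p, t) \<Rightarrow> Z p t)"
      by (rule continuous_on_compose2[OF cont]) (auto intro!: continuous_intros simp: True)
    then have "continuous_on {0..t} (\<lambda>s. Z q s)" using p by (auto elim: continuous_on_subset)
    then have "continuous_on (closure {0..<t}) (\<lambda>s. Z q s)"
      using p \<open>t \<noteq> 0\<close> by (simp add: closure_atLeastLessThan)
    then show ?thesis
      by (rule continuous_le_on_closure)
        (use before p \<open>t \<noteq> 0\<close> in \<open>auto simp: closure_atLeastLessThan less_imp_le\<close>)
  qed (use outside[of q t] p in auto)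
  show thesis
    by (rule that[of t p]) (use p \<open>t \<noteq> 0\<close> before at[of p] at in auto)
qed

section \<open>Propagation of the modulus of continuity\<close>

lemma esssup_le_imp_pointwise_le:
  fixes f :: "'a::euclidean_space \<Rightarrow> real"
  assumes f: "continuous_on UNIV f" and sup: "esssup lborel (\<lambda>x. ereal \<bar>f x\<bar>) \<le> ereal c"
  shows "\<bar>f x\<bar> \<le> c"
proof (rule ccontr)
  assume "\<not> \<bar>f x\<bar> \<le> c"
  define U where "U = {z. c < \<bar>f z\<bar>}"
  have "x \<in> U" using \<open>\<not> \<bar>f x\<bar> \<le> c\<close> by (simp add: U_def)
  have "open U" unfolding U_def
    by (intro open_Collect_less continuous_intros f)
  have "AE z in lborel. ereal \<bar>f z\<bar> \<le> ereal c"
    using esssup_AE[of "\<lambda>x. ereal \<bar>f x\<bar>" lborel]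
    by eventually_elim (rule order_trans[OF _ sup])
  then have "AE z in lborel. z \<notin> U" by (auto simp: U_def elim: eventually_mono)
  moreover have "U \<in> sets lborel" using \<open>open U\<close> by simp
  ultimately have "U \<in> null_sets lborel" by (simp add: AE_iff_null_sets)
  then have "negligible U" using negligible_iff_null_sets null_sets_completionI by blast
  then show False
    using open_not_negligible[OF \<open>open U\<close>] \<open>x \<in> U\<close> by blast
qed

lemma strictly_increasing_le_limit:
  fixes f :: "real \<Rightarrow> real"
  assumes deriv: "\<And>r. 0 < r \<Longrightarrow> \<exists>d>0. (f has_real_derivative d) (at r)"
    and lim: "(f \<longlongrightarrow> l) at_top" and r: "0 < r"
  shows "f r \<le> l"
proof (rule tendsto_lowerbound[OF lim _ trivial_limit_at_top_linorder])
  have "f r \<le> f s" if "r < s" for s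
  proof (rule less_imp_le, rule DERIV_pos_imp_increasing[OF that])
    fix z assume "r \<le> z"
    then show "\<exists>d. (f has_real_derivative d) (at z) \<and> 0 < d"
      using deriv[of z] r by auto
  qed
  then show "\<forall>\<^sub>F s in at_top. f r \<le> f s"
    by (rule eventually_mono[OF eventually_gt_at_top[of r]])
qed

theorem theorem2p3:
  fixes \<rho> :: "real^'n \<Rightarrow> real"
    and k :: 'n
    and u :: "real^'n \<Rightarrow> real \<Rightarrow> real"
    and u0 :: "real^'n \<Rightarrow> real"
    and \<phi> :: "real \<Rightarrow> real \<Rightarrow> real"
  assumes rho_L1: "integrable lborel \<rho>"
    and rho_nonneg: "\<And>x. 0 \<le> \<rho> x"
    and rho_sym: "radially_symmetric \<rho>"
    and rho_mono: "radially_nonincreasing \<rho>"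
    and rho_decay: "(\<rho> \<longlongrightarrow> 0) at_infinity"
    and u_cont: "continuous_on (UNIV \<times> {0..}) (\<lambda>(x, t). u x t)"
    and u_heat: "\<And>x t. t > 0 \<Longrightarrow>
        ((\<lambda>s. u x s) has_real_derivative nonlocal_op \<rho> (\<lambda>z. u z t) x) (at t)"
    and u_init: "\<And>x. u x 0 = u0 x"
    and u_bound: "\<And>t. t \<ge> 0 \<Longrightarrow> esssup lborel (\<lambda>x. ereal \<bar>u x t\<bar>) \<le> 1"
    and phi_nonneg: "\<And>r t. r \<ge> 0 \<Longrightarrow> t \<ge> 0 \<Longrightarrow> 0 \<le> \<phi> r t"
    and phi_cont: "continuous_on ({0..} \<times> {0..}) (\<lambda>(r, t). \<phi> r t)"
    and phi_deriv: "\<And>r t. r > 0 \<Longrightarrow> t \<ge> 0 \<Longrightarrow>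
        \<exists>d>0. ((\<lambda>s. \<phi> s t) has_real_derivative d) (at r)"
    and phi_lim0: "\<And>t. t \<ge> 0 \<Longrightarrow> ((\<lambda>r. \<phi> r t) \<longlongrightarrow> \<phi> 0 t) (at_right 0)"
    and phi_0: "\<And>t. t \<ge> 0 \<Longrightarrow> \<phi> 0 t = 0"
    and phi_init: "modulus_of_continuity_on UNIV (\<lambda>r. \<phi> r 0) (\<lambda>x. u x 0)"
    and phi_top: "\<And>t. t \<ge> 0 \<Longrightarrow> ((\<lambda>r. odd_extension \<phi> r t) \<longlongrightarrow> 1) at_top"
    and phi_bot: "\<And>t. t \<ge> 0 \<Longrightarrow> ((\<lambda>r. odd_extension \<phi> r t) \<longlongrightarrow> (-1)) at_bot"
    and phi_heat: "\<And>r t. t > 0 \<Longrightarrow>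
        ((\<lambda>s. odd_extension \<phi> r s) has_real_derivative
           (\<integral>w. reduced_kernel \<rho> k w *
              (odd_extension \<phi> (r + w) t - odd_extension \<phi> r t) \<partial>lborel)) (at t)"
    and Psi: "\<exists>\<Psi> :: real^'n \<Rightarrow> real.
        smooth \<Psi> \<and> radially_symmetric \<Psi> \<and> (\<forall>x. 1 \<le> \<Psi> x) \<and>
        filterlim \<Psi> at_top at_infinity \<and>
        (\<forall>x. integrable lborel (\<lambda>z. \<rho> (z - x) * (\<Psi> z - \<Psi> x))) \<and>
        bdd_above (range (nonlocal_op \<rho> \<Psi>)) \<and>
        0 \<le> (SUP x. nonlocal_op \<rho> \<Psi> x)"
  shows "\<forall>t\<ge>0. modulus_of_continuity_on UNIV (\<lambda>r. \<phi> r t) (\<lambda>x. u x t)"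
proof -
  obtain \<Psi> :: "real^'n \<Rightarrow> real" where Psi_smooth: "smooth \<Psi>"
    and Psi_ge1: "\<And>x. 1 \<le> \<Psi> x" and Psi_lim: "filterlim \<Psi> at_top at_infinity"
    and Psi_int: "\<And>x. integrable lborel (\<lambda>z. \<rho> (z - x) * (\<Psi> z - \<Psi> x))"
    and Psi_bdd: "bdd_above (range (nonlocal_op \<rho> \<Psi>))"
    and Psi_sup: "0 \<le> (SUP x. nonlocal_op \<rho> \<Psi> x)"
    using Psi by blast
  define K where "K = (SUP x. nonlocal_op \<rho> \<Psi> x)"
  have K: "0 \<le> K" "\<And>x. nonlocal_op \<rho> \<Psi> x \<le> K"
    using Psi_sup Psi_bdd by (auto simp: K_def intro: cSUP_upper)
  have Psi_cont: "continuous_on A \<Psi>" for A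
    using Psi_smooth C_diff.simps(1) continuous_on_subset[of UNIV \<Psi> A] unfolding smooth_def by blast
  have Psi_meas: "\<Psi> \<in> borel_measurable borel"
    by (rule borel_measurable_continuous_onI[OF Psi_cont])
  have u_cont_x: "continuous_on UNIV (\<lambda>x. u x t)" if "0 \<le> t" for t
    using continuous_on_compose2[OF u_cont, of UNIV "\<lambda>x. (x, t)"] that
    by (auto simp: image_subset_iff continuous_on_Pair)
  have u_le1: "\<bar>u x t\<bar> \<le> 1" if "0 \<le> t" for x t
    using esssup_le_imp_pointwise_le[OF u_cont_x[OF that], of 1 x] u_bound[OF that]
    by (simp add: one_ereal_def)
  have phi_le1: "\<phi> r t \<le> 1" if "0 \<le> r" "0 \<le> t" for r t
  proof (cases "r = 0")
    case False
    have "((\<lambda>r. \<phi> r t) \<longlongrightarrow> 1) at_top"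
      using phi_top[OF \<open>0 \<le> t\<close>]
      by (rule Lim_transform_eventually)
        (auto intro: eventually_mono[OF eventually_ge_at_top[of 0]] simp: odd_extension_def)
    then show ?thesis
      using strictly_increasing_le_limit[of "\<lambda>r. \<phi> r t" 1 r] phi_deriv that False by simp
  qed (use phi_0 that in simp)
  have phi_cont_r: "continuous_on {0..} (\<lambda>r. \<phi> r t)" if "0 \<le> t" for t
    using continuous_on_compose2[OF phi_cont, of "{0..}" "\<lambda>r. (r, t)"] that
    by (auto simp: image_subset_iff continuous_on_Pair)
  have odd_meas: "(\<lambda>r. odd_extension \<phi> r t) \<in> borel_measurable borel" if "0 \<le> t" for t
  proof -
    have "continuous_on UNIV (\<lambda>r. \<phi> \<bar>r\<bar> t)"
      by (rule continuous_on_compose2[OF phi_cont_r[OF that]]) (auto intro!: continuous_intros)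
    then have [measurable]: "(\<lambda>r. \<phi> \<bar>r\<bar> t) \<in> borel_measurable borel"
      by (rule borel_measurable_continuous_onI)
    have "(\<lambda>r. odd_extension \<phi> r t) = (\<lambda>r. if 0 \<le> r then \<phi> \<bar>r\<bar> t else - \<phi> \<bar>r\<bar> t)"
      by (auto simp: odd_extension_def)
    then show ?thesis by simp
  qed
  have odd_bound: "\<bar>odd_extension \<phi> r t\<bar> \<le> 1" if "0 \<le> t" for r t
    using phi_le1[of r t] phi_le1[of "- r" t] phi_nonneg[of r t] phi_nonneg[of "- r" t] that
    by (auto simp: odd_extension_def)
  have odd_odd: "odd_extension \<phi> (- r) t = - odd_extension \<phi> r t" if "0 \<le> t" for r t
    using phi_0[OF that] by (auto simp: odd_extension_def)

  \<comment> \<open>The rate \<open>K + 1\<close> makes the penalty grow faster than the operator, at most \<open>K\<close> on \<open>\<Psi>\<close>,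
    can feed it.\<close>
  define Z :: "real \<Rightarrow> (real^'n) \<times> (real^'n) \<Rightarrow> real \<Rightarrow> real" where
    "Z \<epsilon> p t = u (snd p) t - u (fst p) t - 2 * \<phi> (norm (snd p - fst p) / 2) t
      - \<epsilon> * exp ((K + 1) * t) * (\<Psi> (fst p) + \<Psi> (snd p))" for \<epsilon> p t
  have Z_neg: "Z \<epsilon> p T < 0" if "0 < \<epsilon>" "0 \<le> T" for \<epsilon> p T
  proof (rule ccontr)
    assume "\<not> Z \<epsilon> p T < 0"
    then have reached: "0 \<le> Z \<epsilon> p T" by simp
    have penalty: "\<epsilon> * (\<Psi> x + \<Psi> y) \<le> \<epsilon> * exp ((K + 1) * t) * (\<Psi> x + \<Psi> y)" if "0 \<le> t" for x y t
    proof -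
      have "1 \<le> exp ((K + 1) * t)" using K(1) that by simp
      then show ?thesis
        using \<open>0 < \<epsilon>\<close> Psi_ge1[of x] Psi_ge1[of y] by (intro mult_right_mono) auto
    qed
    obtain R where R: "\<And>x. R \<le> norm x \<Longrightarrow> 2 / \<epsilon> \<le> \<Psi> x"
      using Psi_lim unfolding filterlim_at_top eventually_at_infinity by blast
    let ?Q = "cball 0 R \<times> cball 0 R :: ((real^'n) \<times> (real^'n)) set"
    have cont: "continuous_on (?Q \<times> {0..T}) (\<lambda>(p, t). Z \<epsilon> p t)"
      unfolding Z_def case_prod_beta
      by (intro continuous_intros continuous_on_compose2[OF Psi_cont[of UNIV]]
          continuous_on_compose2[OF u_cont, of _ "\<lambda>z. (snd (fst z), snd z)", simplified]
          continuous_on_compose2[OF u_cont, of _ "\<lambda>z. (fst (fst z), snd z)", simplified]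
          continuous_on_compose2[OF phi_cont, of _ "\<lambda>z. (norm (snd (fst z) - fst (fst z)) / 2, snd z)", simplified])
        auto
    have outside: "Z \<epsilon> q t < 0" if "q \<notin> ?Q" "0 \<le> t" for q t
    proof -
      obtain x y where q: "q = (x, y)" by force
      have "2 / \<epsilon> < \<Psi> x + \<Psi> y"
        using that(1) R[of x] R[of y] Psi_ge1[of x] Psi_ge1[of y] by (auto simp: q)
      then have "2 < \<epsilon> * (\<Psi> x + \<Psi> y)" using \<open>0 < \<epsilon>\<close> by (simp add: field_simps)
      then show ?thesis
        using penalty[OF that(2), of x y] u_le1[OF that(2), of x] u_le1[OF that(2), of y]
          phi_nonneg[of "norm (y - x) / 2" t] that(2)
        by (simp add: Z_def q)
    qed
    have init: "Z \<epsilon> q 0 < 0" for q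
    proof -
      obtain x y where q: "q = (x, y)" by force
      have "u y 0 - u x 0 \<le> 2 * \<phi> (norm (y - x) / 2) 0"
        using phi_init unfolding modulus_of_continuity_on_def by (metis UNIV_I abs_le_D1)
      moreover have "0 < \<epsilon> * (\<Psi> x + \<Psi> y)"
        using \<open>0 < \<epsilon>\<close> Psi_ge1[of x] Psi_ge1[of y] by simp
      ultimately show ?thesis by (simp add: Z_def q)
    qed
    have Q: "compact ?Q" by (intro compact_Times compact_cball)
    obtain q t where t: "0 < t" "t \<le> T" and zero: "Z \<epsilon> q t = 0"
      and before: "\<And>q' s. 0 \<le> s \<Longrightarrow> s < t \<Longrightarrow> Z \<epsilon> q' s < 0" and max: "\<And>q'. Z \<epsilon> q' t \<le> 0"
      by (rule first_contact[OF Q cont _ init \<open>0 \<le> T\<close> reached]) (erule (1) outside, blast)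
    obtain x y where q: "q = (x, y)" by force
    let ?r = "norm (y - x) / 2"
    let ?I = "\<integral>w. reduced_kernel \<rho> k w * (odd_extension \<phi> (?r + w) t - odd_extension \<phi> ?r t) \<partial>lborel"
    define \<delta> where "\<delta> = \<epsilon> * exp ((K + 1) * t)"
    have \<delta>: "0 < \<delta>" using \<open>0 < \<epsilon>\<close> by (simp add: \<delta>_def)
    have Psi_pos: "2 \<le> \<Psi> x + \<Psi> y" using Psi_ge1[of x] Psi_ge1[of y] by linarith
    \<comment> \<open>On the diagonal \<open>Z\<close> is minus the penalty, which is positive.\<close>
    have "x \<noteq> y"
    proof
      assume "x = y"
      then have "\<delta> * (\<Psi> x + \<Psi> y) = 0" using zero phi_0[of t] t by (simp add: Z_def q \<delta>_def)
      then show False using \<delta> Psi_pos by simp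
    qed
    have contact_le: "nonlocal_op \<rho> (\<lambda>z. u z t) y - nonlocal_op \<rho> (\<lambda>z. u z t) x
        \<le> 2 * ?I + \<delta> * (nonlocal_op \<rho> \<Psi> x + nonlocal_op \<rho> \<Psi> y)"
    proof (rule nonlocal_op_difference_le[OF rho_L1 rho_nonneg rho_sym rho_mono _ u_le1 odd_meas
          odd_bound odd_odd Psi_meas _ Psi_int \<open>x \<noteq> y\<close>])
      show "u z t - u w t \<le> 2 * odd_extension \<phi> (norm (z - w) / 2) t + \<delta> * (\<Psi> w + \<Psi> z)" for z w
        using max[of "(w, z)"] by (simp add: Z_def odd_extension_def \<delta>_def)
      show "u y t - u x t = 2 * odd_extension \<phi> ?r t + \<delta> * (\<Psi> x + \<Psi> y)"
        using zero by (simp add: Z_def q odd_extension_def \<delta>_def)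
      show "0 \<le> \<Psi> z" for z using Psi_ge1[of z] by linarith
      show "(\<lambda>z. u z t) \<in> borel_measurable borel"
        using t by (intro borel_measurable_continuous_onI u_cont_x) simp
    qed (use t \<delta> in auto)
    have phi_t: "((\<lambda>s. \<phi> ?r s) has_real_derivative ?I) (at t)"
      using phi_heat[of t ?r] t by (simp add: odd_extension_def)
    have penalty_t: "((\<lambda>s. \<epsilon> * exp ((K + 1) * s) * (\<Psi> x + \<Psi> y)) has_real_derivative
        (K + 1) * \<delta> * (\<Psi> x + \<Psi> y)) (at t)"
      by (auto intro!: derivative_eq_intros simp: \<delta>_def)
    have "((\<lambda>s. Z \<epsilon> q s) has_real_derivative
        nonlocal_op \<rho> (\<lambda>z. u z t) y - nonlocal_op \<rho> (\<lambda>z. u z t) x - 2 * ?I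
        - (K + 1) * \<delta> * (\<Psi> x + \<Psi> y)) (at t)"
      unfolding Z_def q fst_conv snd_conv
      by (intro DERIV_diff DERIV_cmult u_heat phi_t penalty_t t)
    from DERIV_nonneg_at_first_zero[OF this t(1) zero less_imp_le[OF before]]
    have "0 \<le> nonlocal_op \<rho> (\<lambda>z. u z t) y - nonlocal_op \<rho> (\<lambda>z. u z t) x - 2 * ?I
        - (K + 1) * \<delta> * (\<Psi> x + \<Psi> y)" .
    \<comment> \<open>The operator raises \<open>Z\<close> at rate at most \<open>2 * K * \<delta>\<close>;
        the growth of the penalty lowers it at rate at least \<open>2 * (K + 1) * \<delta>\<close>.\<close>
    moreover have "\<delta> * (nonlocal_op \<rho> \<Psi> x + nonlocal_op \<rho> \<Psi> y) \<le> \<delta> * (2 * K)"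
      using K(2)[of x] K(2)[of y] \<delta> by (intro mult_left_mono) auto
    moreover have "(K + 1) * \<delta> * 2 \<le> (K + 1) * \<delta> * (\<Psi> x + \<Psi> y)"
      using K(1) \<delta> Psi_pos by (intro mult_left_mono) auto
    ultimately show False using contact_le \<delta> by (simp add: algebra_simps)
  qed
  have one_sided: "u y t - u x t \<le> 2 * \<phi> (norm (y - x) / 2) t" if "0 \<le> t" for x y t
  proof (rule field_le_epsilon)
    \<comment> \<open>Let the penalty parameter tend to zero at the fixed pair of points.\<close>
    fix \<eta> :: real assume "0 < \<eta>"
    define M where "M = exp ((K + 1) * t) * (\<Psi> x + \<Psi> y)"
    have "0 < \<Psi> x + \<Psi> y" using Psi_ge1[of x] Psi_ge1[of y] by linarith
    then have "0 < M" by (simp add: M_def)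
    then have "Z (\<eta> / M) (x, y) t < 0" using Z_neg \<open>0 < \<eta>\<close> that by simp
    moreover have "\<eta> / M * exp ((K + 1) * t) * (\<Psi> x + \<Psi> y) = \<eta>"
      using \<open>0 < M\<close> by (simp add: M_def[symmetric] mult.assoc)
    ultimately show "u y t - u x t \<le> 2 * \<phi> (norm (y - x) / 2) t + \<eta>" by (simp add: Z_def)
  qed
  show ?thesis
  proof (intro allI impI)
    fix t :: real assume t: "0 \<le> t"
    show "modulus_of_continuity_on UNIV (\<lambda>r. \<phi> r t) (\<lambda>x. u x t)"
      unfolding modulus_of_continuity_on_def
    proof (intro conjI allI impI ballI)
      show "continuous (at 0 within {0..}) (\<lambda>r. \<phi> r t)"
        using phi_cont_r[OF t] by (simp add: continuous_on_eq_continuous_within)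
      fix x y
      show "\<bar>u y t - u x t\<bar> \<le> 2 * \<phi> (norm (y - x) / 2) t"
        using one_sided[OF t, of y x] one_sided[OF t, of x y] by (simp add: abs_le_iff norm_minus_commute)
    qed (use phi_nonneg phi_0 t in auto)
  qed
qed

end
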